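(* Let $B$ be the ordinal sum of copulas $\{B_k\mid k=1,\ldots,n\}$ with respect to a finite family $\{(a_k,b_k)\mid k=1,\ldots,n\}$ of disjoint open subintervals of $[0,1]$. Then Spearman's rho of $B$ is $$\rho(B)=1-\sum_{k=1}^n(b_k-a_k)^3(1-\rho(B_k)).$$
   Context: Let $\mathbb{I}=[0,1]$. A (bivariate) copula is a function $C:\mathbb{I}^2\to\mathbb{I}$ with $C(0,v)=C(u,0)=0$, $C(u,1)=u$, $C(1,v)=v$ for all $u,v\in\mathbb{I}$, and $C(u_2,v_2)-C(u_2,v_1)-C(u_1,v_2)+C(u_1,v_1)\ge 0$ whenever $u_1\le u_2$, $v_1\le v_2$ in $\mathbb{I}$. Given disjoint open subintervals $(a_k,b_k)$ of $\mathbb{I}$ and copulas $B_k$, $k=1,\ldots,n$, the ordinal sum $B$ of $\{B_k\}$ with respect to $\{(a_k,b_k)\}$ is the copula defined by $B(u,v)=a_k+(b_k-a_k)B_k\big(\frac{u-a_k}{b_k-a_k},\frac{v-a_k}{b_k-a_k}\big)$ if $(u,v)\in[a_k,b_k]^2$ for some $k$, and $B(u,v)=\min\{u,v\}$ otherwise. Spearman's rho of a copula $C$ is $\rho(C)=12\int_{\mathbb{I}^2}C(u,v)\,du\,dv-3$. *)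

theory Defs
  imports "HOL-Analysis.Analysis"
begin

text \<open>A function on the unit square is represented by a total function on pairs of reals
  of which only the values on the unit square matter.\<close>

definition copula :: "(real \<Rightarrow> real \<Rightarrow> real) \<Rightarrow> bool" where
  "copula C \<longleftrightarrow>
     (\<forall>u\<in>{0..1}. \<forall>v\<in>{0..1}. C u v \<in> {0..1}) \<and>
     (\<forall>v\<in>{0..1}. C 0 v = 0) \<and>
     (\<forall>u\<in>{0..1}. C u 0 = 0) \<and>
     (\<forall>u\<in>{0..1}. C u 1 = u) \<and>
     (\<forall>v\<in>{0..1}. C 1 v = v) \<and>
     (\<forall>u1\<in>{0..1}. \<forall>u2\<in>{0..1}. \<forall>v1\<in>{0..1}. \<forall>v2\<in>{0..1}.
        u1 \<le> u2 \<longrightarrow> v1 \<le> v2 \<longrightarrow>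
        C u2 v2 - C u2 v1 - C u1 v2 + C u1 v1 \<ge> 0)"

text \<open>The closed squares of two disjoint open intervals can share a corner, so the choice
  of \<open>k\<close> below is not always unique; \<open>ordinal_sum_on_square\<close> shows that the
  value does not depend on it.\<close>

definition ordinal_sum ::
  "nat \<Rightarrow> (nat \<Rightarrow> real) \<Rightarrow> (nat \<Rightarrow> real) \<Rightarrow> (nat \<Rightarrow> real \<Rightarrow> real \<Rightarrow> real) \<Rightarrow> real \<Rightarrow> real \<Rightarrow> real"
where
  "ordinal_sum n a b B u v =
     (if \<exists>k\<in>{1..n}. u \<in> {a k..b k} \<and> v \<in> {a k..b k}
      then let k = SOME k. k \<in> {1..n} \<and> u \<in> {a k..b k} \<and> v \<in> {a k..b k}
           in a k + (b k - a k) * B k ((u - a k) / (b k - a k)) ((v - a k) / (b k - a k))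
      else min u v)"

definition spearman_rho :: "(real \<Rightarrow> real \<Rightarrow> real) \<Rightarrow> real" where
  "spearman_rho C = 12 * (LINT (u, v):{0..1} \<times> {0..1}|lborel. C u v) - 3"

lemma ordinal_sum_on_square:
  assumes cop: "\<And>k. k \<in> {1..n} \<Longrightarrow> copula (B k)"
    and ab: "\<And>k. k \<in> {1..n} \<Longrightarrow> a k < b k"
    and disj: "disjoint_family_on (\<lambda>k. {a k<..<b k}) {1..n}"
    and k: "k \<in> {1..n}" and u: "u \<in> {a k..b k}" and v: "v \<in> {a k..b k}"
  shows "ordinal_sum n a b B u v =
    a k + (b k - a k) * B k ((u - a k) / (b k - a k)) ((v - a k) / (b k - a k))"
proof -
  define j where "j = (SOME k. k \<in> {1..n} \<and> u \<in> {a k..b k} \<and> v \<in> {a k..b k})"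
  have j: "j \<in> {1..n} \<and> u \<in> {a j..b j} \<and> v \<in> {a j..b j}"
    unfolding j_def by (rule someI[where x = k]) (use k u v in auto)
  have eq: "ordinal_sum n a b B u v =
    a j + (b j - a j) * B j ((u - a j) / (b j - a j)) ((v - a j) / (b j - a j))"
    unfolding ordinal_sum_def Let_def j_def[symmetric] using k u v by auto
  have corner: "a i + (b i - a i) * B i ((c - a i) / (b i - a i)) ((c - a i) / (b i - a i)) = c"
    if "i \<in> {1..n}" "c = a i \<or> c = b i" for i c
    using cop[OF that(1)] ab[OF that(1)] that(2) by (auto simp: copula_def)
  show ?thesis
  proof (cases "j = k")
    case True
    then show ?thesis using eq by simp
  next
    case False
    then have "{a j<..<b j} \<inter> {a k<..<b k} = {}"
      using disj j k by (auto simp: disjoint_family_on_def)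
    then have "b j \<le> a k \<or> b k \<le> a j"
      using ab[of j] ab[OF k] j by (auto simp: not_less max_def min_def split: if_splits)
    then have c: "v = u" "u = a j \<or> u = b j" "u = a k \<or> u = b k"
      using j u v by auto
    show ?thesis
      using eq corner[OF _ c(2)] corner[OF k c(3)] j c(1) by simp
  qed
qed

end

theory Submission
  imports Defs
begin

text \<open>
  Subtracting the comonotone copula \<open>min\<close> turns the ordinal sum into a genuine sum: on the unit
  square, \<open>B - min\<close> is the sum of the rescaled differences \<open>B\<^sub>k - min\<close>, each extended by zero
  outside \<open>[a\<^sub>k, b\<^sub>k]\<^sup>2\<close>. Rescaling contributes a factor \<open>b\<^sub>k - a\<^sub>k\<close> from the values and
  \<open>(b\<^sub>k - a\<^sub>k)\<^sup>2\<close> from the area, and \<open>min\<close> itself has Spearman's rho 1.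
\<close>

text \<open>The two bounds are the rectangle inequality on [u1,u2] x [0,v] and on [u1,u2] x [v,1];
  the boundary conditions evaluate the terms on the edges at height 0 and 1.\<close>

lemma copula_increment_left:
  assumes "copula C" "u1 \<in> {0..1}" "u2 \<in> {0..1}" "v \<in> {0..1}" "u1 \<le> u2"
  shows "0 \<le> C u2 v - C u1 v" "C u2 v - C u1 v \<le> u2 - u1"
proof -
  have rect: "C x2 y2 - C x2 y1 - C x1 y2 + C x1 y1 \<ge> 0"
    if "x1 \<in> {0..1}" "x2 \<in> {0..1}" "y1 \<in> {0..1}" "y2 \<in> {0..1}" "x1 \<le> x2" "y1 \<le> y2"
    for x1 x2 y1 y2
    using assms(1) that unfolding copula_def by blast
  have "C u1 0 = 0" "C u2 0 = 0" "C u1 1 = u1" "C u2 1 = u2"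
    using assms unfolding copula_def by blast+
  then show "0 \<le> C u2 v - C u1 v" "C u2 v - C u1 v \<le> u2 - u1"
    using rect[of u1 u2 0 v] rect[of u1 u2 v 1] assms by auto
qed

lemma copula_flip:
  assumes "copula C"
  shows "copula (\<lambda>u v. C v u)"
  unfolding copula_def
proof (intro conjI ballI impI)
  fix u1 u2 v1 v2 :: real
  assume "u1 \<in> {0..1}" "u2 \<in> {0..1}" "v1 \<in> {0..1}" "v2 \<in> {0..1}" "u1 \<le> u2" "v1 \<le> v2"
  then have "C v2 u2 - C v2 u1 - C v1 u2 + C v1 u1 \<ge> 0"
    using assms unfolding copula_def by blast
  then show "C v2 u2 - C v1 u2 - C v2 u1 + C v1 u1 \<ge> 0" by simp
qed (use assms in \<open>unfold copula_def, blast\<close>)+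

lemma copula_lipschitz_left:
  assumes "copula C" "u1 \<in> {0..1}" "u2 \<in> {0..1}" "v \<in> {0..1}"
  shows "\<bar>C u2 v - C u1 v\<bar> \<le> \<bar>u2 - u1\<bar>"
  using copula_increment_left[OF assms] copula_increment_left[OF assms(1,3,2,4)]
  by (cases "u1 \<le> u2") auto

text \<open>Move from (u1,v1) to (u2,v2) through (u1,v2), changing one coordinate at a time;
  \<open>copula_flip\<close> supplies the bound for the second coordinate.\<close>

lemma copula_lipschitz:
  assumes "copula C" "u1 \<in> {0..1}" "u2 \<in> {0..1}" "v1 \<in> {0..1}" "v2 \<in> {0..1}"
  shows "\<bar>C u2 v2 - C u1 v1\<bar> \<le> \<bar>u2 - u1\<bar> + \<bar>v2 - v1\<bar>"
  using copula_lipschitz_left[OF assms(1-3,5)]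
    copula_lipschitz_left[OF copula_flip[OF assms(1)] assms(4,5,2)]
  by linarith

text \<open>Measurability is not part of \<open>copula\<close>; continuity on the compact square is
  what yields integrability below.\<close>

lemma continuous_on_copula:
  assumes "copula C"
  shows "continuous_on ({0..1} \<times> {0..1}) (\<lambda>(u, v). C u v)"
proof -
  \<comment> \<open>The constant 2 arises because each coordinate distance is at most the Euclidean
    distance of the pairs.\<close>
  have "2-lipschitz_on ({0..1} \<times> {0..1}) (\<lambda>(u, v). C u v)"
  proof (rule lipschitz_onI; clarify?)
    fix u1 v1 u2 v2 :: real
    assume *: "u1 \<in> {0..1}" "v1 \<in> {0..1}" "u2 \<in> {0..1}" "v2 \<in> {0..1}"
    have "dist u1 u2 \<le> dist (u1, v1) (u2, v2)" "dist v1 v2 \<le> dist (u1, v1) (u2, v2)"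
      using dist_fst_le[of "(u1, v1)" "(u2, v2)"] dist_snd_le[of "(u1, v1)" "(u2, v2)"] by auto
    then show "dist (C u1 v1) (C u2 v2) \<le> 2 * dist (u1, v1) (u2, v2)"
      using copula_lipschitz[OF assms *(3,1,4,2)] by (simp add: dist_real_def)
  qed simp
  then show "continuous_on ({0..1} \<times> {0..1}) (\<lambda>(u, v). C u v)"
    by (rule lipschitz_on_continuous_on)
qed

lemma set_integrable_copula:
  assumes "copula C"
  shows "set_integrable lborel ({0..1} \<times> {0..1}) (\<lambda>(u, v). C u v)"
  unfolding set_integrable_def
  by (intro borel_integrable_compact compact_Times continuous_on_copula assms) auto

lemma copula_min: "copula min"
  by (auto simp: copula_def min_def)

lemma has_integral_min:
  fixes u :: real
  assumes "u \<in> {0..1}"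
  shows "(min u has_integral (u - u\<^sup>2 / 2)) {0..1}"
proof -
  have "((\<lambda>v. v) has_integral u\<^sup>2 / 2 - 0\<^sup>2 / 2) {0..u}"
    using assms by (intro fundamental_theorem_of_calculus)
      (auto intro!: derivative_eq_intros simp flip: has_real_derivative_iff_has_vector_derivative)
  then have "((\<lambda>v. v) has_integral u\<^sup>2 / 2) {0..u}"
    by simp
  \<comment> \<open>Split at v = u: \<open>min u v\<close> is v to the left and the constant u to
    the right.\<close>
  then have 1: "(min u has_integral u\<^sup>2 / 2) {0..u}"
    by (rule has_integral_eq[rotated]) auto
  have "((\<lambda>v. u) has_integral u * (1 - u)) {u..1}"
    using has_integral_const_real[of u u 1] assms by (simp add: mult.commute)
  then have 2: "(min u has_integral u * (1 - u)) {u..1}"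
    by (rule has_integral_eq[rotated]) auto
  show ?thesis
    using has_integral_combine[OF _ _ 1 2] assms by (simp add: algebra_simps power2_eq_square)
qed

lemma spearman_rho_min: "spearman_rho min = 1"
proof -
  have *: "{0..1} \<times> {0..1} = cbox (0, 0) (1 :: real, 1 :: real)"
    by (simp add: cbox_Pair_eq)
  have "(LINT (u, v):{0..1} \<times> {0..1}|lborel. min u v :: real) =
      integral (cbox (0, 0) (1, 1)) (\<lambda>(u, v). min u v)"
    using set_borel_integral_eq_integral(2)[OF set_integrable_copula[OF copula_min]]
    by (simp add: *)
  also have "\<dots> = integral {0..1} (\<lambda>u. integral {0..1} (min u))"
    using integral_prod_continuous[of 0 0 1 1 "\<lambda>(u, v). min u v :: real"]
      continuous_on_copula[OF copula_min]
    by (simp add: *)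
  also have "\<dots> = integral {0..1} (\<lambda>u. u - u\<^sup>2 / 2)"
    by (intro integral_cong integral_unique has_integral_min)
  also have "((\<lambda>u::real. u - u\<^sup>2 / 2) has_integral (1\<^sup>2 / 2 - 1 ^ 3 / 6) - (0\<^sup>2 / 2 - 0 ^ 3 / 6)) {0..1}"
    by (intro fundamental_theorem_of_calculus)
      (auto intro!: derivative_eq_intros simp flip: has_real_derivative_iff_has_vector_derivative)
  then have "integral {0..1} (\<lambda>u::real. u - u\<^sup>2 / 2) = 1 / 3"
    by (simp add: integral_unique)
  finally show ?thesis
    by (simp add: spearman_rho_def)
qed

text \<open>Change of variables: the image of Lebesgue measure under the affine map, reweighted by
  the Jacobian, is Lebesgue measure again.\<close>

lemma has_bochner_integral_lborel_affine:
  fixes f :: "'a::euclidean_space \<Rightarrow> 'b::{banach, second_countable_topology}"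
  assumes "has_bochner_integral lborel f i" and c: "c \<noteq> 0"
  shows "has_bochner_integral lborel (\<lambda>x. f (t + c *\<^sub>R x)) (i /\<^sub>R \<bar>c\<bar> ^ DIM('a))"
proof -
  have f [measurable]: "f \<in> borel_measurable borel" 
    using assms(1) by (auto simp: has_bochner_integral_iff)
  have T [measurable]: "(\<lambda>x::'a. t + c *\<^sub>R x) \<in> lborel \<rightarrow>\<^sub>M borel"
    by measurable
  have "has_bochner_integral (density (distr lborel borel (\<lambda>x. t + c *\<^sub>R x)) (\<lambda>_. ennreal (\<bar>c\<bar> ^ DIM('a)))) f i"
    using assms(1) lborel_affine[OF c, of t] by (simp add: ennreal_power)
  then have "has_bochner_integral lborel (\<lambda>x. \<bar>c\<bar> ^ DIM('a) *\<^sub>R f (t + c *\<^sub>R x)) i"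
    using T by (simp add: has_bochner_integral_iff integrable_density integral_density
        integrable_distr_eq integral_distr)
  from has_bochner_integral_scaleR_right[OF this, of "inverse (\<bar>c\<bar> ^ DIM('a))"]
  show ?thesis using c by simp
qed

text \<open>The indicator discards the arbitrary values of \<open>C\<close> off the unit square, so
  rescaled copies can be integrated over the whole plane and added.\<close>

definition excess :: "(real \<Rightarrow> real \<Rightarrow> real) \<Rightarrow> real \<times> real \<Rightarrow> real" where
  "excess C p = indicator ({0..1} \<times> {0..1}) p * (C (fst p) (snd p) - min (fst p) (snd p))"

text \<open>The integral of a copula D over the square is (rho(D) + 3) / 12, which is 1/3 for
  \<open>min\<close>; subtract.\<close>

lemma has_bochner_integral_excess:
  assumes "copula C"
  shows "has_bochner_integral lborel (excess C) ((spearman_rho C - 1) / 12)"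
proof -
  let ?I = "{0..1} \<times> {0..1 :: real}"
  have "has_bochner_integral lborel (\<lambda>p. indicator ?I p *\<^sub>R (\<lambda>(u, v). D u v) p)
      ((spearman_rho D + 3) / 12)" if "copula D" for D
    using set_integrable_copula[OF that]
    by (simp add: spearman_rho_def set_integrable_def set_lebesgue_integral_def has_bochner_integral_iff)
  from has_bochner_integral_diff[OF this[OF assms] this[OF copula_min]]
  have "has_bochner_integral lborel (excess C) ((spearman_rho C + 3) / 12 - (1 + 3) / 12)"
    by (simp add: excess_def [abs_def] spearman_rho_min case_prod_beta right_diff_distrib)
  then show ?thesis
    by (simp add: diff_divide_distrib add_divide_distrib)
qed

lemma has_bochner_integral_excess_rescaled:
  assumes "copula C" "\<alpha> < \<beta>"
  shows "has_bochner_integral lborel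
    (\<lambda>(u, v). (\<beta> - \<alpha>) * excess C ((u - \<alpha>) / (\<beta> - \<alpha>), (v - \<alpha>) / (\<beta> - \<alpha>)))
    ((\<beta> - \<alpha>) ^ 3 * ((spearman_rho C - 1) / 12))"
proof -
  define d where "d = \<beta> - \<alpha>"
  have d: "d > 0" using assms by (simp add: d_def)
  \<comment> \<open>The rescaling is written as a translation plus a scaling by 1/d; in dimension 2
    its inverse Jacobian is d^2.\<close>
  have "has_bochner_integral lborel (\<lambda>p. d * excess C ((- \<alpha> / d, - \<alpha> / d) + (1 / d) *\<^sub>R p))
      (d * (((spearman_rho C - 1) / 12) /\<^sub>R \<bar>1 / d\<bar> ^ DIM(real \<times> real)))"
    using d by (intro has_bochner_integral_mult_right has_bochner_integral_lborel_affine
        has_bochner_integral_excess assms) auto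
  moreover have "(- \<alpha> / d, - \<alpha> / d) + (1 / d) *\<^sub>R p = ((fst p - \<alpha>) / d, (snd p - \<alpha>) / d)" for p
    by (cases p) (simp add: diff_divide_distrib)
  moreover have "d * (((spearman_rho C - 1) / 12) /\<^sub>R \<bar>1 / d\<bar> ^ DIM(real \<times> real)) =
      d ^ 3 * ((spearman_rho C - 1) / 12)"
    using d by (simp add: power_divide power3_eq_cube power2_eq_square)
  ultimately show ?thesis
    unfolding case_prod_beta d_def by (simp only:)
qed

text \<open>The rescaled point lies in the unit square exactly when (u,v) lies in
  [\<alpha>,\<beta>]^2, and rescaling \<open>min\<close> back gives
  \<open>min u v - \<alpha>\<close>, which accounts for the summand \<alpha>.\<close>

lemma excess_rescaled:
  assumes "\<alpha> < \<beta>"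
  shows "(\<beta> - \<alpha>) * excess C ((u - \<alpha>) / (\<beta> - \<alpha>), (v - \<alpha>) / (\<beta> - \<alpha>)) =
    (if u \<in> {\<alpha>..\<beta>} \<and> v \<in> {\<alpha>..\<beta>}
     then \<alpha> + (\<beta> - \<alpha>) * C ((u - \<alpha>) / (\<beta> - \<alpha>)) ((v - \<alpha>) / (\<beta> - \<alpha>)) - min u v else 0)"
proof -
  have "(x - \<alpha>) / (\<beta> - \<alpha>) \<in> {0..1} \<longleftrightarrow> x \<in> {\<alpha>..\<beta>}" for x
    using assms by (auto simp: field_simps)
  moreover have "(\<beta> - \<alpha>) * min ((u - \<alpha>) / (\<beta> - \<alpha>)) ((v - \<alpha>) / (\<beta> - \<alpha>)) = min u v - \<alpha>"
    using assms by (auto simp: min_def divide_le_cancel)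
  ultimately show ?thesis
    by (auto simp: excess_def right_diff_distrib indicator_def)
qed

text \<open>At every point at most one summand is nonzero: outside all squares there is none, and on
  the square of k every other summand vanishes.\<close>

lemma ordinal_sum_minus_min:
  assumes cop: "\<And>k. k \<in> {1..n} \<Longrightarrow> copula (B k)"
    and ab: "\<And>k. k \<in> {1..n} \<Longrightarrow> a k < b k"
    and disj: "disjoint_family_on (\<lambda>k. {a k<..<b k}) {1..n}"
  shows "ordinal_sum n a b B u v - min u v =
    (\<Sum>k=1..n. (b k - a k) * excess (B k) ((u - a k) / (b k - a k), (v - a k) / (b k - a k)))"
    (is "?L = (\<Sum>k=1..n. ?e k)")
proof (cases "\<exists>k\<in>{1..n}. u \<in> {a k..b k} \<and> v \<in> {a k..b k}")
  case False
  then have "?e k = 0" if "k \<in> {1..n}" for k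
    using that by (auto simp: excess_rescaled[OF ab[OF that]])
  then have "(\<Sum>k=1..n. ?e k) = 0"
    by (intro sum.neutral ballI)
  moreover have "?L = 0"
    by (simp only: ordinal_sum_def if_not_P[OF False] diff_self)
  ultimately show ?thesis by simp
next
  case True
  then obtain k where k: "k \<in> {1..n}" "u \<in> {a k..b k}" "v \<in> {a k..b k}"
    by blast
  have "?e j = 0" if j: "j \<in> {1..n}" "j \<noteq> k" for j
  proof (cases "u \<in> {a j..b j} \<and> v \<in> {a j..b j}")
    case True
    have "{a j<..<b j} \<inter> {a k<..<b k} = {}"
      using disj j k by (auto simp: disjoint_family_on_def)
    then have "b j \<le> a k \<or> b k \<le> a j"
      using ab[OF j(1)] ab[OF k(1)] by (auto simp: not_less max_def min_def split: if_splits)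
    \<comment> \<open>The closed squares of j and k can meet only in a common corner on the
      diagonal. It rescales to (0,0) or (1,1), where every copula agrees with
      \<open>min\<close>.\<close>
    then have "v = u" "u = a j \<or> u = b j"
      using True k by auto
    then show ?thesis
      using cop[OF j(1)] ab[OF j(1)] by (auto simp: excess_def copula_def)
  next
    case False
    then show ?thesis by (auto simp: excess_rescaled[OF ab[OF j(1)]])
  qed
  then have "(\<Sum>k=1..n. ?e k) = (\<Sum>j\<in>{k}. ?e j)"
    using k by (intro sum.mono_neutral_right) auto
  also have "\<dots> = ?L"
    using ordinal_sum_on_square[OF cop ab disj k] k by (simp add: excess_rescaled[OF ab[OF k(1)]])
  finally show ?thesis by simp
qed

theorem proposition3p1:
  fixes n :: nat and a b :: "nat \<Rightarrow> real" and B :: "nat \<Rightarrow> real \<Rightarrow> real \<Rightarrow> real"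
  assumes "\<And>k. k \<in> {1..n} \<Longrightarrow> copula (B k)"
    and "\<And>k. k \<in> {1..n} \<Longrightarrow> 0 \<le> a k \<and> a k < b k \<and> b k \<le> 1"
    and "disjoint_family_on (\<lambda>k. {a k<..<b k}) {1..n}"
  shows "spearman_rho (ordinal_sum n a b B) =
    1 - (\<Sum>k=1..n. (b k - a k) ^ 3 * (1 - spearman_rho (B k)))"
proof -
  let ?I = "{0..1} \<times> {0..1 :: real}"
  let ?e = "\<lambda>k (u, v). (b k - a k) * excess (B k) ((u - a k) / (b k - a k), (v - a k) / (b k - a k))"
  let ?m = "\<lambda>p. indicator ?I p *\<^sub>R (\<lambda>(u, v). min u v) p"
  have ab: "a k < b k" if "k \<in> {1..n}" for k
    using assms(2)[OF that] by simp
  \<comment> \<open>This is where 0 \<le> \<open>a k\<close> and \<open>b k\<close> \<le> 1 enter: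
    each square lies inside the unit square.\<close>
  have "?e k (u, v) = 0" if "k \<in> {1..n}" "(u, v) \<notin> ?I" for k u v
    using assms(2)[OF that(1)] that(2) by (auto simp: excess_rescaled)
  then have outside: "(\<Sum>k=1..n. ?e k p) = 0" if "p \<notin> ?I" for p
    using that by (cases p) (blast intro: sum.neutral)
  \<comment> \<open>Off the unit square \<open>min\<close> need not vanish, so its term keeps the
    indicator; the rescaled excesses vanish there by themselves.\<close>
  have eq: "indicator ?I p *\<^sub>R (\<lambda>(u, v). ordinal_sum n a b B u v) p = ?m p + (\<Sum>k=1..n. ?e k p)"
    for p
  proof (cases "p \<in> ?I")
    case True
    moreover have "(\<lambda>(u, v). ordinal_sum n a b B u v) p = (\<lambda>(u, v). min u v) p + (\<Sum>k=1..n. ?e k p)"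
      unfolding case_prod_beta
      by (subst ordinal_sum_minus_min[where u = "fst p" and v = "snd p", OF assms(1) ab assms(3), symmetric]) auto
    ultimately show ?thesis by (simp only: indicator_simps scaleR_one)
  next
    case False
    show ?thesis
      unfolding outside[OF False] indicator_simps(2)[OF False] by simp
  qed
  have min: "has_bochner_integral lborel ?m (1 / 3)"
    using set_integrable_copula[OF copula_min] spearman_rho_min
    by (simp add: spearman_rho_def set_integrable_def set_lebesgue_integral_def has_bochner_integral_iff)
  have "has_bochner_integral lborel (\<lambda>p. ?m p + (\<Sum>k=1..n. ?e k p))
      (1 / 3 + (\<Sum>k=1..n. (b k - a k) ^ 3 * ((spearman_rho (B k) - 1) / 12)))"
    by (intro has_bochner_integral_add has_bochner_integral_sum min
        has_bochner_integral_excess_rescaled assms(1) ab)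
  then have "(LINT (u, v):?I|lborel. ordinal_sum n a b B u v) =
      1 / 3 + (\<Sum>k=1..n. (b k - a k) ^ 3 * ((spearman_rho (B k) - 1) / 12))"
    unfolding set_lebesgue_integral_def eq by (rule has_bochner_integral_integral_eq)
  \<comment> \<open>The factor -1/12 cancels the 12 in Spearman's rho, while 12 * (1/3) - 3 gives
    the leading 1.\<close>
  moreover have "(\<Sum>k=1..n. (b k - a k) ^ 3 * ((spearman_rho (B k) - 1) / 12)) =
      (\<Sum>k=1..n. (b k - a k) ^ 3 * (1 - spearman_rho (B k))) * (- 1 / 12)"
    unfolding sum_distrib_right by (intro sum.cong) (simp_all add: field_simps)
  ultimately show ?thesis
    by (simp add: spearman_rho_def[of "ordinal_sum n a b B"])
qed

end
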